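(* Let $(Y,\tau)$ be a topological space and $(Z,\mathcal{U})$ a uniform space. A topology $\mathfrak{T}$ on $EC(Y,Z)$ is splitting if and only if its dual topology $\mathbb{T}(\mathfrak{T})$ on $\mathcal{O}_Z(Y)$ is splitting.
   Context: Uniform spaces $(Z,\mathcal{U})$ are given in the usual sense by a family $\mathcal{U}$ of entourages on a non-empty set $Z$. For $U\in\mathcal{U}$ and $z\in Z$, $U[z]=\{w\in Z : (z,w)\in U\}$. Equi-continuity: a function $f:(X,\tau)\to(Z,\mathcal{U})$ from a topological space to a uniform space is equi-continuous at $x\in X$ if for each $U\in\mathcal{U}$ there is an open neighbourhood $V$ of $x$ with $f(V)\subseteq U[f(x)]$; it is equi-continuous if this holds at all $x\in X$. $EC(Y,Z)$ is the set of all equi-continuous functions from $Y$ to $Z$. The set $\mathcal{O}_Z(Y)$: for each $U\in\mathcal{U}$, $f\in EC(Y,Z)$, $y\in Y$ fix an open neighbourhood of $y$ in $Y$, denoted $U(f,y)$, with $f(U(f,y))\subseteq U[f(y)]$ (it exists by equi-continuity). Put $\mathcal{O}_Z(Y)=\{U(f,y) : U\in\mathcal{U}, f\in EC(Y,Z), y\in Y\}$. Dual topology: for $\mathcal{H}\subseteq EC(Y,Z)$ and $U\in\mathcal{U}$ let $(\mathcal{H},U)=\{U(f,y) : f\in\mathcal{H}, y\in Y\}\subseteq\mathcal{O}_Z(Y)$. For a topology $\mathfrak{T}$ on $EC(Y,Z)$, its dual $\mathbb{T}(\mathfrak{T})$ is the topology on $\mathcal{O}_Z(Y)$ generated by the subbasis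 $\{(\mathcal{H},U) : \mathcal{H}\in\mathfrak{T}, U\in\mathcal{U}\}$. Associated maps: for a topological space $X$, maps $g:X\times Y\to Z$ and $g^*:X\to EC(Y,Z)$ are associated if $g^*(x)(y)=g(x,y)$ for all $x\in X$, $y\in Y$ (if $g$ is equi-continuous on the product space $X\times Y$, each $g(x,\cdot)$ lies in $EC(Y,Z)$). For associated $g,g^*$ define the multifunction $\overline{g}:X\times\mathcal{U}\to\mathcal{O}_Z(Y)$ by $\overline{g}(x,U)=\{U(g^*(x),y) : y\in Y\}$. Upper semi continuity: a multifunction $F:X\to W$ between topological spaces is upper semi continuous if for each $x\in X$ and each open $V\subseteq W$ with $F(x)\subseteq V$ there is an open $O\ni x$ with $F(x')\subseteq V$ for all $x'\in O$. A multifunction $M:X\times\mathcal{U}\to\mathcal{O}_Z(Y)$ is upper semi continuous with respect to the first variable if for every fixed $U\in\mathcal{U}$ the multifunction $M_U:X\to\mathcal{O}_Z(Y)$, $M_U(x)=M(x,U)$, is upper semi continuous. Splitting: a topology $\mathfrak{T}$ on $EC(Y,Z)$ is splitting if for each topological space $(X,\mu)$, equi-continuity of a map $g:X\times Y\to Z$ implies continuity of its associated map $g^*:X\to(EC(Y,Z),\mathfrak{T})$. A topology $\mathbb{T}$ on $\mathcal{O}_Z(Y)$ is splitting if for each topological space $(X,\mu)$, equi-continuity of a map $g:X\times Y\to Z$ implies upper semi continuity with respect to the first variable of $\overline{g}:X\times\mathcal{U}\to(\mathcal{O}_Z(Y),\mathbb{T})$.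
   Formalization: The elements U(f,y) of O_Z(Y) are taken as an indexed family (the open set together with its index (U,f,y)), not as bare subsets of Y; with bare subsets the claim fails, e.g. for Y one point, Z the reals and the discrete topology on EC(Y,Z). *)

theory Defs
  imports "HOL-Analysis.Analysis"
begin

definition entourages :: "('z::uniform_space \<times> 'z) set set" where
  "entourages = {U. eventually (\<lambda>p. p \<in> U) uniformity}"

definition equi_continuous :: "'a topology \<Rightarrow> ('a \<Rightarrow> 'z::uniform_space) \<Rightarrow> bool" where
  "equi_continuous X f \<longleftrightarrow>
     (\<forall>x\<in>topspace X. \<forall>U\<in>entourages. \<exists>V. openin X V \<and> x \<in> V \<and> f ` V \<subseteq> U `` {f x})"

text \<open>Functions on the space \<open>Y\<close> are represented by their extensional representatives, so that
  equality in \<open>EC Y\<close> is equality of functions on the carrier of \<open>Y\<close>.\<close>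

definition EC :: "'y topology \<Rightarrow> ('y \<Rightarrow> 'z::uniform_space) set" where
  "EC Y = {f \<in> extensional (topspace Y). equi_continuous Y f}"

type_synonym ('y, 'z) nbhd_choice = "('z \<times> 'z) set \<Rightarrow> ('y \<Rightarrow> 'z) \<Rightarrow> 'y \<Rightarrow> 'y set"

definition nbhd_selection :: "'y topology \<Rightarrow> ('y, 'z::uniform_space) nbhd_choice \<Rightarrow> bool" where
  "nbhd_selection Y N \<longleftrightarrow>
     (\<forall>U\<in>entourages. \<forall>f\<in>EC Y. \<forall>y\<in>topspace Y.
        openin Y (N U f y) \<and> y \<in> N U f y \<and> f ` (N U f y) \<subseteq> U `` {f y})"

text \<open>The selected neighbourhoods \<open>U(f,y)\<close> form an indexed family: \<open>U(f,y)\<close> is the chosen open set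
  together with its index \<open>(U, f, y)\<close>, and is not identified with a \<open>U'(f',y')\<close> that happens to be
  the same subset of \<open>Y\<close>.  If only the underlying sets were kept, the sets \<open>(H,U)\<close> below would no
  longer determine \<open>H\<close>: over a one-point \<open>Y\<close> all \<open>U(f,y)\<close> coincide, so every topology on them is
  splitting, whereas the discrete topology on \<open>EC Y\<close> (with real values, say) is not.\<close>

type_synonym ('y, 'z) indexed_nbhd = "(('z \<times> 'z) set \<times> ('y \<Rightarrow> 'z) \<times> 'y) \<times> 'y set"

definition sel_nbhd ::
  "('y, 'z) nbhd_choice \<Rightarrow> ('z \<times> 'z) set \<Rightarrow> ('y \<Rightarrow> 'z) \<Rightarrow> 'y \<Rightarrow> ('y, 'z) indexed_nbhd" where
  "sel_nbhd N U f y = ((U, f, y), N U f y)"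

definition nbhd_space ::
  "'y topology \<Rightarrow> ('y, 'z::uniform_space) nbhd_choice \<Rightarrow> ('y, 'z) indexed_nbhd set" where
  "nbhd_space Y N = {sel_nbhd N U f y | U f y. U \<in> entourages \<and> f \<in> EC Y \<and> y \<in> topspace Y}"

definition nbhds_of ::
  "'y topology \<Rightarrow> ('y, 'z::uniform_space) nbhd_choice \<Rightarrow> ('y \<Rightarrow> 'z) set \<Rightarrow> ('z \<times> 'z) set
     \<Rightarrow> ('y, 'z) indexed_nbhd set" where
  "nbhds_of Y N H U = {sel_nbhd N U f y | f y. f \<in> H \<and> y \<in> topspace Y}"

definition dual_topology ::
  "'y topology \<Rightarrow> ('y, 'z::uniform_space) nbhd_choice \<Rightarrow> ('y \<Rightarrow> 'z) topology
     \<Rightarrow> ('y, 'z) indexed_nbhd topology" where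
  "dual_topology Y N T =
     topology_generated_by {nbhds_of Y N H U | H U. openin T H \<and> U \<in> entourages}"

lemma topspace_dual_topology:
  assumes "topspace T = EC Y"
  shows "topspace (dual_topology Y N T) = nbhd_space Y N"
proof -
  have "H \<subseteq> EC Y" if "openin T H" for H
    using that assms openin_subset by blast
  moreover have "openin T (EC Y)"
    using assms openin_topspace by metis
  ultimately show ?thesis
    unfolding dual_topology_def topology_generated_by_topspace nbhd_space_def nbhds_of_def
    by blast
qed

definition assoc_map :: "'y topology \<Rightarrow> ('x \<times> 'y \<Rightarrow> 'z) \<Rightarrow> 'x \<Rightarrow> 'y \<Rightarrow> 'z" where
  "assoc_map Y g x = (\<lambda>y\<in>topspace Y. g (x, y))"

definition assoc_multifun ::
  "'y topology \<Rightarrow> ('y, 'z) nbhd_choice \<Rightarrow> ('x \<times> 'y \<Rightarrow> 'z) \<Rightarrow> 'x \<times> ('z \<times> 'z) set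
     \<Rightarrow> ('y, 'z) indexed_nbhd set" where
  "assoc_multifun Y N g = (\<lambda>(x, U). {sel_nbhd N U (assoc_map Y g x) y | y. y \<in> topspace Y})"

definition upper_semi_continuous :: "'x topology \<Rightarrow> 'w topology \<Rightarrow> ('x \<Rightarrow> 'w set) \<Rightarrow> bool" where
  "upper_semi_continuous X W F \<longleftrightarrow>
     (\<forall>x\<in>topspace X. \<forall>V. openin W V \<and> F x \<subseteq> V \<longrightarrow>
        (\<exists>G. openin X G \<and> x \<in> G \<and> (\<forall>x'\<in>G. F x' \<subseteq> V)))"

definition usc_first ::
  "'x topology \<Rightarrow> 'w topology \<Rightarrow> ('x \<times> ('z::uniform_space \<times> 'z) set \<Rightarrow> 'w set) \<Rightarrow> bool" where
  "usc_first X W M \<longleftrightarrow> (\<forall>U\<in>entourages. upper_semi_continuous X W (\<lambda>x. M (x, U)))"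

text \<open>A definition cannot quantify over all types; the test spaces \<open>X\<close> range over all
  topologies with carrier contained in an arbitrary type \<open>'x\<close>, which is a parameter.\<close>

definition splitting :: "'x itself \<Rightarrow> 'y topology \<Rightarrow> ('y \<Rightarrow> 'z::uniform_space) topology \<Rightarrow> bool" where
  "splitting _ Y T \<longleftrightarrow>
     (\<forall>(X :: 'x topology) g. equi_continuous (prod_topology X Y) g \<longrightarrow>
        continuous_map X T (assoc_map Y g))"

definition nbhd_splitting ::
  "'x itself \<Rightarrow> 'y topology \<Rightarrow> ('y, 'z::uniform_space) nbhd_choice
     \<Rightarrow> ('y, 'z) indexed_nbhd topology \<Rightarrow> bool" where
  "nbhd_splitting _ Y N S \<longleftrightarrow>
     (\<forall>(X :: 'x topology) g. equi_continuous (prod_topology X Y) g \<longrightarrow>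
        usc_first X S (assoc_multifun Y N g))"

end

theory Submission
  imports Defs
begin

text \<open>Because the neighbourhoods carry their indices, the \<open>U\<close>-slice of every open set of the dual
  topology has the form \<open>(H, U)\<close> with \<open>H\<close> open in \<open>T\<close>: this holds for the subbasis and is stable under
  unions and finite intersections.  Hence a map \<open>h\<close> into \<open>EC Y\<close> is continuous if and only if each
  multifunction \<open>x \<mapsto> ({h x}, U)\<close> is upper semi continuous, and both notions of splitting
  express this for the same maps \<open>h = g\<^sup>*\<close>.\<close>

lemma UNIV_entourage: "UNIV \<in> entourages"
  by (simp add: entourages_def)

text \<open>Freezing \<open>x\<close> in an open box \<open>A \<times> B\<close> around
  \<open>(x, y)\<close> leaves \<open>B\<close> as the required neighbourhood of
  \<open>y\<close>.\<close>

lemma assoc_map_in_EC: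
  assumes g: "equi_continuous (prod_topology X Y) g" and x: "x \<in> topspace X"
  shows "assoc_map Y g x \<in> EC Y"
proof -
  have "\<exists>V. openin Y V \<and> y \<in> V \<and> assoc_map Y g x ` V \<subseteq> U `` {assoc_map Y g x y}"
    if y: "y \<in> topspace Y" and U: "U \<in> entourages" for y U
  proof -
    obtain W where W: "openin (prod_topology X Y) W" "(x, y) \<in> W" "g ` W \<subseteq> U `` {g (x, y)}"
      using g x y U unfolding equi_continuous_def by fastforce
    then obtain A B where AB: "openin X A" "openin Y B" "x \<in> A" "y \<in> B" "A \<times> B \<subseteq> W"
      unfolding openin_prod_topology_alt by metis
    have "assoc_map Y g x y' \<in> U `` {assoc_map Y g x y}" if "y' \<in> B" for y'
    proof -
      \<comment> \<open>Only on the carrier of \<open>Y\<close> does the restricted function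
        \<open>assoc_map Y g x\<close> agree with \<open>g (x, _)\<close>.\<close>
      have "y' \<in> topspace Y"
        using AB(2) that openin_subset by blast
      moreover have "g (x, y') \<in> U `` {g (x, y)}"
        using AB W(3) that by blast
      ultimately show ?thesis
        using y by (simp add: assoc_map_def)
    qed
    then show ?thesis
      using AB by blast
  qed
  then show ?thesis
    by (auto simp: EC_def equi_continuous_def assoc_map_def)
qed

text \<open>Injectivity comes from the stored index alone, whatever sets \<open>N\<close> selects;
  it lets \<open>f\<close> be recovered from a neighbourhood.\<close>

lemma sel_nbhd_eq_iff: "sel_nbhd N U f y = sel_nbhd N U' f' y' \<longleftrightarrow> U = U' \<and> f = f' \<and> y = y'"
  by (auto simp: sel_nbhd_def)

lemma sel_nbhd_in_nbhds_of:
  "sel_nbhd N U f y \<in> nbhds_of Y N H U' \<longleftrightarrow> U = U' \<and> f \<in> H \<and> y \<in> topspace Y"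
  by (auto simp: nbhds_of_def sel_nbhd_eq_iff)

lemma openin_dual_topology_nbhds_of:
  "openin T H \<Longrightarrow> U \<in> entourages \<Longrightarrow> openin (dual_topology Y N T) (nbhds_of Y N H U)"
  unfolding dual_topology_def by (rule topology_generated_by_Basis) blast

text \<open>A subbasic set contains the neighbourhoods with index \<open>(U, f, y)\<close> for all
  \<open>y\<close> or for none. Hence a single \<open>H\<close> serves every
  \<open>y\<close>.\<close>

lemma openin_dual_topology_slice:
  assumes "openin (dual_topology Y N T) V"
  shows "\<exists>H. openin T H \<and> (\<forall>f. \<forall>y\<in>topspace Y. sel_nbhd N U f y \<in> V \<longleftrightarrow> f \<in> H)"
proof -
  have "generate_topology_on {nbhds_of Y N H U | H U. openin T H \<and> U \<in> entourages} V"
    using assms unfolding dual_topology_def openin_topology_generated_by_iff .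
  then show ?thesis
  proof induction
    case Empty
    show ?case
      by (rule exI[of _ "{}"]) simp
  next
    case (Int A B)
    then obtain H K where "openin T H" "\<forall>f. \<forall>y\<in>topspace Y. sel_nbhd N U f y \<in> A \<longleftrightarrow> f \<in> H"
      and "openin T K" "\<forall>f. \<forall>y\<in>topspace Y. sel_nbhd N U f y \<in> B \<longleftrightarrow> f \<in> K"
      by blast
    then show ?case
      by (intro exI[of _ "H \<inter> K"]) auto
  next
    case (UN \<K>)
    then obtain h where "\<forall>A\<in>\<K>. openin T (h A) \<and>
        (\<forall>f. \<forall>y\<in>topspace Y. sel_nbhd N U f y \<in> A \<longleftrightarrow> f \<in> h A)"
      by metis
    then show ?case
      by (intro exI[of _ "\<Union>(h ` \<K>)"]) auto
  next
    case (Basis A)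
    then obtain H U' where "A = nbhds_of Y N H U'" "openin T H"
      by blast
    then show ?case
      \<comment> \<open>A subbasic set built from another entourage has no member with first index
        \<open>U\<close>, so its slice is empty.\<close>
      by (intro exI[of _ "if U' = U then H else {}"]) (auto simp: sel_nbhd_in_nbhds_of)
  qed
qed

lemma continuous_map_iff_usc_dual:
  assumes T: "topspace T = EC Y" and h: "\<And>x. x \<in> topspace X \<Longrightarrow> h x \<in> EC Y"
  shows "continuous_map X T h \<longleftrightarrow>
    usc_first X (dual_topology Y N T) (\<lambda>(x, U). {sel_nbhd N U (h x) y | y. y \<in> topspace Y})"
    (is "_ \<longleftrightarrow> usc_first X ?D ?M")
proof (cases "topspace Y = {}")
  \<comment> \<open>Both sides hold here: \<open>EC Y\<close> is a single point, which makes
    \<open>h\<close> constant on \<open>X\<close>, and every value of the multifunction is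
    empty.\<close>
  case True
  have "f = (\<lambda>_. undefined)" if "f \<in> EC Y" for f :: "'a \<Rightarrow> 'b"
    using that True by (auto simp: EC_def)
  then have "h x = (\<lambda>_. undefined)" if "x \<in> topspace X" for x
    using h that by blast
  moreover have "(\<lambda>_. undefined) \<in> topspace T"
    using True by (simp add: T EC_def equi_continuous_def)
  then have "continuous_map X T (\<lambda>_. \<lambda>_. undefined)"
    by simp
  ultimately have "continuous_map X T h"
    by (auto intro: continuous_map_eq[where f = "\<lambda>_ _. undefined"])
  moreover have "usc_first X ?D ?M"
    using True by (auto simp: usc_first_def upper_semi_continuous_def)
  ultimately show ?thesis
    by simp
next
  case False
  then obtain y where y: "y \<in> topspace Y"
    by blast
  show ?thesis
  proof
    assume cont: "continuous_map X T h"
    show "usc_first X ?D ?M"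
      unfolding usc_first_def upper_semi_continuous_def
    proof (intro ballI allI impI, elim conjE)
      fix U x V
      assume x: "x \<in> topspace X" and V: "openin ?D V" "?M (x, U) \<subseteq> V"
      obtain H where H: "openin T H" "\<And>f y. y \<in> topspace Y \<Longrightarrow> sel_nbhd N U f y \<in> V \<longleftrightarrow> f \<in> H"
        using openin_dual_topology_slice[OF V(1)] by metis
      \<comment> \<open>One point \<open>y\<close> of \<open>Y\<close> suffices to read off
        membership in \<open>H\<close>.\<close>
      have "h x \<in> H"
        using V(2) H(2)[OF y] y by blast
      moreover have "openin X {x \<in> topspace X. h x \<in> H}"
        using cont H(1) by (rule openin_continuous_map_preimage)
      ultimately show "\<exists>G. openin X G \<and> x \<in> G \<and> (\<forall>x'\<in>G. ?M (x', U) \<subseteq> V)"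
        using x H(2) by (intro exI[of _ "{x \<in> topspace X. h x \<in> H}"]) auto
    qed
  next
    assume "usc_first X ?D ?M"
    \<comment> \<open>Any single entourage would do, since the index determines \<open>h x\<close>
      whichever entourage is fixed; \<open>UNIV\<close> is always available.\<close>
    then have usc: "upper_semi_continuous X ?D (\<lambda>x. ?M (x, UNIV))"
      using UNIV_entourage by (auto simp: usc_first_def)
    have "openin X {x \<in> topspace X. h x \<in> H}" if H: "openin T H" for H
    \<comment> \<open>Upper semi continuity is local, so openness of the preimage is checked around
      each of its points.\<close>
    proof (subst openin_subopen, intro ballI)
      fix x
      assume x: "x \<in> {x \<in> topspace X. h x \<in> H}"
      then have "?M (x, UNIV) \<subseteq> nbhds_of Y N H UNIV"
        by (auto simp: sel_nbhd_in_nbhds_of)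
      moreover have "openin ?D (nbhds_of Y N H UNIV)"
        using H UNIV_entourage by (rule openin_dual_topology_nbhds_of)
      ultimately have "\<exists>G. openin X G \<and> x \<in> G \<and> (\<forall>x'\<in>G. ?M (x', UNIV) \<subseteq> nbhds_of Y N H UNIV)"
        using usc[unfolded upper_semi_continuous_def, rule_format, of x] x by simp
      then obtain G where G: "openin X G" "x \<in> G"
        "\<And>x'. x' \<in> G \<Longrightarrow> ?M (x', UNIV) \<subseteq> nbhds_of Y N H UNIV"
        by auto
      have "h x' \<in> H" if "x' \<in> G" for x'
      proof -
        have "sel_nbhd N UNIV (h x') y \<in> nbhds_of Y N H UNIV"
          using G(3)[OF that] y by blast
        then show ?thesis
          by (simp add: sel_nbhd_in_nbhds_of)
      qed
      then show "\<exists>G. openin X G \<and> x \<in> G \<and> G \<subseteq> {x \<in> topspace X. h x \<in> H}"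
        using G(1,2) openin_subset by blast
    qed
    then show "continuous_map X T h"
      using h T by (auto simp: continuous_map)
  qed
qed

theorem theorem5p11:
  fixes Y :: "'y topology"
    and N :: "('y, 'z::uniform_space) nbhd_choice"
    and T :: "('y \<Rightarrow> 'z) topology"
  assumes "nbhd_selection Y N"
    and "topspace T = EC Y"
  shows "splitting TYPE('x) Y T \<longleftrightarrow> nbhd_splitting TYPE('x) Y N (dual_topology Y N T)"
proof -
  \<comment> \<open>The two conclusions agree for each pair \<open>X\<close>, \<open>g\<close>
    separately, so the result holds for every type \<open>'x\<close> of test points.\<close>
  have "continuous_map X T (assoc_map Y g) \<longleftrightarrow>
      usc_first X (dual_topology Y N T) (assoc_multifun Y N g)"
    if "equi_continuous (prod_topology X Y) g" for X :: "'x topology" and g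
    unfolding assoc_multifun_def
    using assms(2) assoc_map_in_EC[OF that] by (rule continuous_map_iff_usc_dual)
  then show ?thesis
    unfolding splitting_def nbhd_splitting_def by blast
qed

end
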